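(* Let $x_k\in\mathrm{dom}\,\psi$, $\gamma_k\in(0,1]$, and let $\bar x_{k+1}=(1-\gamma_k)x_k+\gamma_k\bar v_{k+1}$ with $\bar v_{k+1}\in\mathrm{dom}\,\psi$ satisfy $$\langle\nabla\Omega_p(f,x_k;\bar x_{k+1}),v-\bar v_{k+1}\rangle+\psi(v)\ge\psi(\bar v_{k+1})-\tfrac1{\gamma_k}\xi_{k+1}\quad\text{for all }v\in\mathrm{dom}\,\psi,$$ with some $\xi_{k+1}\ge 0$ such that $\xi_{k+1}\le c\,\gamma_k^{p+1}$ for some constant $c\ge 0$. Then $$\langle\nabla f(\bar x_{k+1}),v-\bar v_{k+1}\rangle+\psi(v)\ge\psi(\bar v_{k+1})-\tfrac1{\gamma_k}\delta_{k+1}\quad\text{for all }v\in\mathrm{dom}\,\psi,$$ with $\delta_{k+1}=\bigl(c+\Gamma^{(p)}_{\mathrm{dom}\,\psi}(f)\bigr)\gamma_k^{p+1}$.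
   Context: Setting. $\mathbb{E}$ is a finite-dimensional real vector space with dual $\mathbb{E}^*$; $\langle s,x\rangle$ is the value of $s\in\mathbb{E}^*$ at $x\in\mathbb{E}$. $\psi:\mathbb{E}\to\mathbb{R}\cup\{+\infty\}$ is a proper closed convex function with bounded domain $\mathrm{dom}\,\psi=\{x:\psi(x)<+\infty\}$, and $f$ is convex and $p\ge 1$ times continuously differentiable at every point of $\mathrm{dom}\,\psi$. $D^if(x)[h]^i$ is the $i$th directional derivative of $f$ at $x$ along $h$ (repeated $i$ times), and $D^if(x)[h]^{i-1}\in\mathbb{E}^*$ denotes $\frac1i$ times the gradient in $h$ of $D^if(x)[h]^i$ (so $D^1f(x)[h]^0=\nabla f(x)$, $D^2f(x)[h]^1=\nabla^2f(x)h$). $\Omega_p(f,x_k;y)=f(x_k)+\sum_{i=1}^p\frac1{i!}D^if(x_k)[y-x_k]^i$ is the Taylor polynomial, and $\nabla\Omega_p(f,x_k;y)$ is its gradient with respect to $y$. For a convex set $Q$, $$\Gamma^{(p)}_Q(f)=\sup_{x,y,v\in Q,\;t\in(0,1]}\frac1{t^p}\Bigl|\Bigl\langle\nabla f(x+t(v-x))-\nabla f(x)-\sum_{i=2}^{p}\frac{t^{i-1}}{(i-1)!}D^if(x)[v-x]^{i-1},\,v-y\Bigr\rangle\Bigr|\in[0,+\infty]$$ (the asserted bound is void if this quantity is $+\infty$). *)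

theory Defs
  imports "HOL-Analysis.Analysis"
begin

definition eff_dom :: "('a \<Rightarrow> ereal) \<Rightarrow> 'a set" where
  "eff_dom \<psi> = {x. \<psi> x < \<infinity>}"

definition ereal_epigraph :: "('a \<Rightarrow> ereal) \<Rightarrow> ('a \<times> real) set" where
  "ereal_epigraph \<psi> = {(x, r). \<psi> x \<le> ereal r}"

definition proper_closed_convex :: "('a::euclidean_space \<Rightarrow> ereal) \<Rightarrow> bool" where
  "proper_closed_convex \<psi> \<longleftrightarrow>
     (\<forall>x. \<psi> x \<noteq> -\<infinity>) \<and> eff_dom \<psi> \<noteq> {} \<and>
     closed (ereal_epigraph \<psi>) \<and> convex (ereal_epigraph \<psi>)"

text \<open>Pointwise continuous differentiability: the derivative exists near \<open>x\<close> and is \<open>k\<close> times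
  continuously differentiable at \<open>x\<close>. In finite dimension it is enough to say the latter for
  each of its values \<open>Df(\<cdot>)h\<close>. Being of class \<open>C\<^sup>k\<close> on a neighbourhood of \<open>x\<close> implies this.\<close>

primrec cont_diff_at :: "nat \<Rightarrow> ('a::euclidean_space \<Rightarrow> real) \<Rightarrow> 'a \<Rightarrow> bool" where
  "cont_diff_at 0 f x \<longleftrightarrow> isCont f x"
| "cont_diff_at (Suc k) f x \<longleftrightarrow>
     (\<forall>\<^sub>F y in nhds x. f differentiable (at y)) \<and>
     (\<forall>h. cont_diff_at k (\<lambda>y. frechet_derivative f (at y) h) x)"

text \<open>The dual space is the type \<open>'a \<Rightarrow>\<^sub>L real\<close>, and the pairing \<open>\<langle>s, x\<rangle>\<close> is application;
  gradients are elements of the dual and do not refer to the inner product of \<open>'a\<close>.\<close>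

definition grad :: "('a::euclidean_space \<Rightarrow> real) \<Rightarrow> 'a \<Rightarrow> ('a \<Rightarrow>\<^sub>L real)" where
  "grad f x = Blinfun (frechet_derivative f (at x))"

definition dir_deriv :: "nat \<Rightarrow> ('a::euclidean_space \<Rightarrow> real) \<Rightarrow> 'a \<Rightarrow> 'a \<Rightarrow> real" where
  "dir_deriv i f x h = (deriv ^^ i) (\<lambda>t::real. f (x + t *\<^sub>R h)) 0"

text \<open>The form \<open>D\<^sup>if(x)[h]\<^sup>i\<close> is homogeneous of degree \<open>i\<close> in \<open>h\<close>, so \<open>1/i\<close> times its gradient in \<open>h\<close>
  is the functional \<open>D\<^sup>if(x)[h]\<^sup>i\<^sup>-\<^sup>1\<close>; for \<open>i = 1\<close> this is the gradient of \<open>f\<close> at \<open>x\<close>.\<close>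

definition dir_deriv_dual ::
    "nat \<Rightarrow> ('a::euclidean_space \<Rightarrow> real) \<Rightarrow> 'a \<Rightarrow> 'a \<Rightarrow> ('a \<Rightarrow>\<^sub>L real)" where
  "dir_deriv_dual i f x h = (1 / real i) *\<^sub>R grad (\<lambda>h. dir_deriv i f x h) h"

definition taylor_poly ::
    "nat \<Rightarrow> ('a::euclidean_space \<Rightarrow> real) \<Rightarrow> 'a \<Rightarrow> 'a \<Rightarrow> real" where
  "taylor_poly p f x y = f x + (\<Sum>i=1..p. 1 / fact i * dir_deriv i f x (y - x))"

definition Gamma_p ::
    "nat \<Rightarrow> 'a set \<Rightarrow> ('a::euclidean_space \<Rightarrow> real) \<Rightarrow> ennreal" where
  "Gamma_p p Q f =
     (SUP (x, y, v, t) \<in> Q \<times> Q \<times> Q \<times> {0<..1::real}.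
        ennreal (1 / t ^ p *
          \<bar>blinfun_apply
             (grad f (x + t *\<^sub>R (v - x)) - grad f x
               - (\<Sum>i=2..p. (t ^ (i - 1) / fact (i - 1)) *\<^sub>R dir_deriv_dual i f x (v - x)))
             (v - y)\<bar>))"

end

theory Submission imports Defs begin

text \<open>
  For each \<open>i \<le> p\<close> the form \<open>h \<mapsto> D\<^sup>if(x)[h]\<^sup>i\<close> is an iterated directional derivative; expanding the
  direction in a basis, one differentiation at a time, shows that it is a homogeneous polynomial in
  \<open>h\<close> of degree \<open>i\<close>. Hence its gradient is homogeneous of degree \<open>i - 1\<close>, and the gradient of the
  Taylor polynomial at \<open>x + \<gamma> (v - x)\<close> is exactly the expression subtracted from
  \<open>\<nabla>f(x + \<gamma> (v - x))\<close> in the definition of \<open>\<Gamma>\<close>. So replacing one gradient by the other costs at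
  most \<open>\<Gamma> \<gamma>\<^sup>p\<close>.
\<close>

section \<open>Iterated derivatives in a fixed direction\<close>

definition along :: "'a::euclidean_space \<Rightarrow> ('a \<Rightarrow> real) \<Rightarrow> 'a \<Rightarrow> real" where
  "along h f = (\<lambda>y. frechet_derivative f (at y) h)"

lemma cont_diff_at_Suc_along:
  "cont_diff_at (Suc k) f x \<longleftrightarrow>
     (\<forall>\<^sub>F y in nhds x. f differentiable (at y)) \<and> (\<forall>h. cont_diff_at k (along h f) x)"
  by (simp add: along_def)

lemma cont_diff_at_SucD: "cont_diff_at (Suc k) f x \<Longrightarrow> cont_diff_at k f x"
proof (induction k arbitrary: f)
  case 0
  then have "f differentiable (at x)"
    by (auto dest: eventually_nhds_x_imp_x)
  then show ?case
    by (simp add: differentiable_imp_continuous_within)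
next
  case (Suc k)
  then show ?case
    by (metis cont_diff_at_Suc_along)
qed

lemma cont_diff_at_le: "cont_diff_at n f x \<Longrightarrow> k \<le> n \<Longrightarrow> cont_diff_at k f x"
  by (induction n) (auto simp: le_Suc_eq simp del: cont_diff_at.simps dest: cont_diff_at_SucD)

text \<open>At nearby points the two functions have exactly the same Frechet derivatives, so
  \<open>frechet_derivative\<close> makes the same choice even where neither is differentiable. The
  conclusion stays a neighbourhood statement so that it can be iterated.\<close>

lemma along_cong_ev:
  assumes "\<forall>\<^sub>F y in nhds x. f y = g y"
  shows "\<forall>\<^sub>F y in nhds x. along h f y = along h g y"
proof -
  have "\<forall>\<^sub>F y in nhds x. \<forall>\<^sub>F z in nhds y. f z = g z"
    using assms by (simp add: eventually_eventually)
  then show ?thesis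
  proof eventually_elim
    case (elim y)
    have eq: "f y = g y" "\<forall>\<^sub>F z in at y. f z = g z" "\<forall>\<^sub>F z in at y. g z = f z"
      using elim eventually_nhds_x_imp_x[OF elim]
      by (auto simp: eventually_at_filter elim: eventually_mono)
    have "(f has_derivative D) (at y) \<longleftrightarrow> (g has_derivative D) (at y)" for D
      using eq by (auto intro: has_derivative_transform_eventually)
    then show ?case
      by (simp add: along_def frechet_derivative_def)
  qed
qed

lemma along_funpow_cong_ev:
  assumes "\<forall>\<^sub>F y in nhds x. f y = g y"
  shows "\<forall>\<^sub>F y in nhds x. (along h ^^ k) f y = (along h ^^ k) g y"
  using assms by (induction k) (auto intro: along_cong_ev)

text \<open>Linearity of differentiation near \<open>x\<close>, where the finitely many summands are
  all differentiable. The innermost derivative is moved into the sum first, and the induction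
  hypothesis then applies to \<open>along h (g b)\<close>.\<close>

lemma along_funpow_sum:
  assumes "finite B" "\<And>b. b \<in> B \<Longrightarrow> cont_diff_at k (g b) x"
  shows "\<forall>\<^sub>F y in nhds x.
           (along h ^^ k) (\<lambda>y. \<Sum>b\<in>B. c b * g b y) y = (\<Sum>b\<in>B. c b * (along h ^^ k) (g b) y)"
  using assms(2)
proof (induction k arbitrary: g)
  case 0
  then show ?case by simp
next
  case (Suc k)
  have "\<forall>\<^sub>F y in nhds x. \<forall>b\<in>B. g b differentiable (at y)"
    using Suc.prems assms(1) by (auto simp: eventually_ball_finite_distrib)
  then have "\<forall>\<^sub>F y in nhds x. along h (\<lambda>y. \<Sum>b\<in>B. c b * g b y) y = (\<Sum>b\<in>B. c b * along h (g b) y)"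
  proof eventually_elim
    case (elim y)
    have "((\<lambda>y. \<Sum>b\<in>B. c b * g b y) has_derivative
            (\<lambda>d. \<Sum>b\<in>B. c b * frechet_derivative (g b) (at y) d)) (at y)"
      using elim by (auto intro!: has_derivative_sum has_derivative_mult_right
          simp: frechet_derivative_works[symmetric])
    then show ?case
      by (simp add: along_def frechet_derivative_at[symmetric])
  qed
  then have "\<forall>\<^sub>F y in nhds x. (along h ^^ k) (along h (\<lambda>y. \<Sum>b\<in>B. c b * g b y)) y =
      (along h ^^ k) (\<lambda>y. \<Sum>b\<in>B. c b * along h (g b) y) y"
    by (rule along_funpow_cong_ev)
  moreover have "\<forall>\<^sub>F y in nhds x. (along h ^^ k) (\<lambda>y. \<Sum>b\<in>B. c b * along h (g b) y) y =
      (\<Sum>b\<in>B. c b * (along h ^^ k) (along h (g b)) y)"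
    using Suc.prems by (intro Suc.IH) (simp add: cont_diff_at_Suc_along del: cont_diff_at.simps)
  ultimately show ?case
    by eventually_elim (simp add: funpow_swap1)
qed

text \<open>Only the innermost direction is expanded in the basis; the coefficients
  \<open>h \<bullet> b\<close> do not depend on the base point, so the outer \<open>k\<close>
  derivatives pass through them. Used as a recursion, this exhibits the form as a polynomial in
  \<open>h\<close>.\<close>

lemma along_funpow_Suc_expand:
  assumes "cont_diff_at (Suc k) f x"
  shows "(along h ^^ Suc k) f x = (\<Sum>b\<in>Basis. (h \<bullet> b) * (along h ^^ k) (along b f) x)"
proof -
  have "\<forall>\<^sub>F y in nhds x. along h f y = (\<Sum>b\<in>Basis. (h \<bullet> b) * along b f y)"
    using assms unfolding cont_diff_at_Suc_along
  proof (elim conjE eventually_mono)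
    fix y
    assume "f differentiable (at y)"
    then have lin: "linear (frechet_derivative f (at y))"
      by (rule linear_frechet_derivative)
    have "frechet_derivative f (at y) h = frechet_derivative f (at y) (\<Sum>b\<in>Basis. (h \<bullet> b) *\<^sub>R b)"
      by (simp add: euclidean_representation)
    also have "\<dots> = (\<Sum>b\<in>Basis. (h \<bullet> b) * frechet_derivative f (at y) b)"
      by (simp add: linear_sum[OF lin] linear_cmul[OF lin])
    finally show "along h f y = (\<Sum>b\<in>Basis. (h \<bullet> b) * along b f y)"
      by (simp add: along_def)
  qed
  then have "\<forall>\<^sub>F y in nhds x. (along h ^^ k) (along h f) y =
      (along h ^^ k) (\<lambda>y. \<Sum>b\<in>Basis. (h \<bullet> b) * along b f y) y"
    by (rule along_funpow_cong_ev)
  moreover have "\<forall>\<^sub>F y in nhds x. (along h ^^ k) (\<lambda>y. \<Sum>b\<in>Basis. (h \<bullet> b) * along b f y) y =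
      (\<Sum>b\<in>Basis. (h \<bullet> b) * (along h ^^ k) (along b f) y)"
    using assms by (intro along_funpow_sum)
      (auto simp: cont_diff_at_Suc_along simp del: cont_diff_at.simps)
  ultimately have "\<forall>\<^sub>F y in nhds x. (along h ^^ k) (along h f) y =
      (\<Sum>b\<in>Basis. (h \<bullet> b) * (along h ^^ k) (along b f) y)"
    by eventually_elim simp
  from eventually_nhds_x_imp_x[OF this] show ?thesis
    by (simp add: funpow_swap1)
qed

text \<open>In the basis expansion the factor \<open>h \<bullet> b\<close> contributes one
  \<open>s\<close>, and the induction hypothesis for \<open>along b f\<close> contributes
  \<open>s ^ k\<close>.\<close>

lemma along_funpow_scaleR:
  "cont_diff_at k f x \<Longrightarrow> (along (s *\<^sub>R h) ^^ k) f x = s ^ k * (along h ^^ k) f x"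
proof (induction k arbitrary: f)
  case 0
  then show ?case by simp
next
  case (Suc k)
  then have "cont_diff_at k (along b f) x" for b
    by (simp add: cont_diff_at_Suc_along del: cont_diff_at.simps)
  then show ?case
    using Suc by (simp add: along_funpow_Suc_expand sum_distrib_left mult_ac
        del: funpow.simps cont_diff_at.simps)
qed

text \<open>Here the direction varies at a fixed base point: each level of the expansion multiplies
  by a linear function of \<open>h\<close>, so the product and sum rules apply.\<close>

lemma along_funpow_differentiable:
  "cont_diff_at k f x \<Longrightarrow> (\<lambda>h. (along h ^^ k) f x) differentiable (at h)"
proof (induction k arbitrary: f)
  case 0
  then show ?case by simp
next
  case (Suc k)
  then have "cont_diff_at k (along b f) x" for b
    by (simp add: cont_diff_at_Suc_along del: cont_diff_at.simps)
  then show ?case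
    using Suc by (auto simp: along_funpow_Suc_expand bounded_linear_inner_left
        simp del: funpow.simps cont_diff_at.simps
        intro!: differentiable_sum differentiable_mult bounded_linear_imp_differentiable)
qed

section \<open>Restriction to a line\<close>

lemma deriv_funpow_cong_ev:
  assumes "\<forall>\<^sub>F t in nhds x. u t = v t"
  shows "\<forall>\<^sub>F t in nhds x. (deriv ^^ k) u t = (deriv ^^ k) v t"
proof (induction k)
  case 0
  then show ?case using assms by simp
next
  case (Suc k)
  then have "\<forall>\<^sub>F t in nhds x. \<forall>\<^sub>F s in nhds t. (deriv ^^ k) u s = (deriv ^^ k) v s"
    by (simp add: eventually_eventually)
  then show ?case
    by eventually_elim (simp add: deriv_cong_ev)
qed

text \<open>By the chain rule, one differentiation in \<open>t\<close> is one application of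
  \<open>along h\<close>. Only \<open>t = 0\<close> matters in the end, but taking the next
  derivative there requires equality on a neighbourhood.\<close>

lemma deriv_funpow_line:
  assumes "cont_diff_at k f x"
  shows "\<forall>\<^sub>F t in nhds 0. (deriv ^^ k) (\<lambda>t. f (x + t *\<^sub>R h)) t = (along h ^^ k) f (x + t *\<^sub>R h)"
  using assms
proof (induction k arbitrary: f)
  case 0
  then show ?case by simp
next
  case (Suc k)
  \<comment> \<open>The line is continuous at \<open>t = 0\<close>, so the neighbourhood of
    \<open>x\<close> on which \<open>f\<close> is differentiable pulls back to one of 0.\<close>
  have "filterlim (\<lambda>t. x + t *\<^sub>R h) (nhds (x + 0 *\<^sub>R h)) (nhds 0)"
    by (intro tendsto_intros filterlim_ident)
  then have "filterlim (\<lambda>t. x + t *\<^sub>R h) (nhds x) (nhds 0)"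
    by simp
  moreover have "\<forall>\<^sub>F y in nhds x. f differentiable (at y)"
    using Suc.prems by simp
  ultimately have "\<forall>\<^sub>F t in nhds 0. f differentiable (at (x + t *\<^sub>R h))"
    by (rule eventually_compose_filterlim[rotated])
  then have "\<forall>\<^sub>F t in nhds 0. deriv (\<lambda>t. f (x + t *\<^sub>R h)) t = along h f (x + t *\<^sub>R h)"
  proof eventually_elim
    case (elim t)
    define F where "F = frechet_derivative f (at (x + t *\<^sub>R h))"
    have F: "(f has_derivative F) (at (x + t *\<^sub>R h))"
      using elim by (simp add: F_def frechet_derivative_works)
    have "((\<lambda>t. x + t *\<^sub>R h) has_derivative (\<lambda>d. d *\<^sub>R h)) (at t)"
      by (auto intro!: derivative_eq_intros)
    from has_derivative_compose[OF this F]
    have "((\<lambda>t. f (x + t *\<^sub>R h)) has_derivative (\<lambda>d. F (d *\<^sub>R h))) (at t)" .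
    moreover have "(\<lambda>d. F (d *\<^sub>R h)) = (*) (F h)"
      by (simp add: fun_eq_iff linear_cmul[OF has_derivative_linear[OF F]])
    ultimately have "((\<lambda>t. f (x + t *\<^sub>R h)) has_field_derivative F h) (at t)"
      by (simp add: has_field_derivative_def)
    then show ?case
      by (simp add: DERIV_imp_deriv along_def F_def)
  qed
  then have "\<forall>\<^sub>F t in nhds 0. (deriv ^^ k) (deriv (\<lambda>t. f (x + t *\<^sub>R h))) t =
      (deriv ^^ k) (\<lambda>t. along h f (x + t *\<^sub>R h)) t"
    by (rule deriv_funpow_cong_ev)
  moreover have "\<forall>\<^sub>F t in nhds 0. (deriv ^^ k) (\<lambda>t. along h f (x + t *\<^sub>R h)) t =
      (along h ^^ k) (along h f) (x + t *\<^sub>R h)"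
    using Suc.prems by (intro Suc.IH) (simp add: cont_diff_at_Suc_along del: cont_diff_at.simps)
  ultimately show ?case
    by eventually_elim (simp add: funpow_swap1)
qed

lemma dir_deriv_eq_along: "cont_diff_at k f x \<Longrightarrow> dir_deriv k f x h = (along h ^^ k) f x"
  using eventually_nhds_x_imp_x[OF deriv_funpow_line, of k f x h] by (simp add: dir_deriv_def)

lemma dir_deriv_scaleR:
  "cont_diff_at k f x \<Longrightarrow> dir_deriv k f x (s *\<^sub>R h) = s ^ k * dir_deriv k f x h"
  by (simp add: dir_deriv_eq_along along_funpow_scaleR)

lemma dir_deriv_differentiable:
  "cont_diff_at k f x \<Longrightarrow> (\<lambda>h. dir_deriv k f x h) differentiable (at h)"
  by (simp add: dir_deriv_eq_along along_funpow_differentiable)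

section \<open>Gradients of the forms and of the Taylor polynomial\<close>

lemma grad_has_derivative:
  "f differentiable (at x) \<Longrightarrow> (f has_derivative blinfun_apply (grad f x)) (at x)"
  unfolding grad_def frechet_derivative_works
  by (simp add: bounded_linear_Blinfun_apply has_derivative_bounded_linear)

lemma grad_eqI:
  assumes "(f has_derivative blinfun_apply D) (at x)"
  shows "grad f x = D"
  using frechet_derivative_at[OF assms] by (metis blinfun_apply_inverse grad_def)

text \<open>Differentiate \<open>P y = s ^ k * P ((1 / s) *\<^sub>R y)\<close>, with
  \<open>P\<close> the form of degree \<open>k\<close>, at \<open>s *\<^sub>R h\<close>: the chain
  rule brings out \<open>1 / s\<close>, which lowers the exponent by one.\<close>

lemma grad_dir_deriv_scaleR:
  assumes "cont_diff_at k f x" "k \<ge> 1" "s \<noteq> 0"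
  shows "grad (dir_deriv k f x) (s *\<^sub>R h) = s ^ (k - 1) *\<^sub>R grad (dir_deriv k f x) h"
proof (rule grad_eqI)
  let ?D = "grad (dir_deriv k f x)"
  have scale: "((\<lambda>y. (1 / s) *\<^sub>R y) has_derivative (\<lambda>d. (1 / s) *\<^sub>R d)) (at (s *\<^sub>R h))"
    by (intro bounded_linear_imp_has_derivative bounded_linear_scaleR_right)
  have "(dir_deriv k f x has_derivative ?D h) (at ((1 / s) *\<^sub>R (s *\<^sub>R h)))"
    using grad_has_derivative[OF dir_deriv_differentiable[OF assms(1)]] assms(3) by simp
  from has_derivative_mult_right[OF has_derivative_compose[OF scale this], of "s ^ k"]
  have "((\<lambda>y. s ^ k * dir_deriv k f x ((1 / s) *\<^sub>R y)) has_derivative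
      (\<lambda>d. s ^ k * ?D h ((1 / s) *\<^sub>R d))) (at (s *\<^sub>R h))" .
  moreover have "s ^ k * dir_deriv k f x ((1 / s) *\<^sub>R y) = dir_deriv k f x y" for y
    using assms(3) by (subst dir_deriv_scaleR[OF assms(1), symmetric]) simp
  moreover have "s ^ k * ?D h ((1 / s) *\<^sub>R d) = (s ^ (k - 1) *\<^sub>R ?D h) d" for d
    using assms(2,3) by (simp add: blinfun.scaleR_right blinfun.scaleR_left power_diff)
  ultimately show "(dir_deriv k f x has_derivative (s ^ (k - 1) *\<^sub>R ?D h)) (at (s *\<^sub>R h))"
    by simp
qed

text \<open>The first-order form is linear in the direction, so its gradient is the same
  everywhere.\<close>

lemma grad_dir_deriv_1:
  assumes "cont_diff_at 1 f x"
  shows "grad (dir_deriv 1 f x) h = grad f x"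
proof (rule grad_eqI)
  have "f differentiable (at x)"
    using assms by (auto dest: eventually_nhds_x_imp_x)
  note D = grad_has_derivative[OF this]
  have "dir_deriv 1 f x = blinfun_apply (grad f x)"
    using frechet_derivative_at[OF D] dir_deriv_eq_along[OF assms]
    by (auto simp: along_def)
  then show "(dir_deriv 1 f x has_derivative blinfun_apply (grad f x)) (at h)"
    by (simp add: bounded_linear_imp_has_derivative blinfun.bounded_linear_right)
qed

lemma grad_taylor_poly:
  assumes "cont_diff_at p f x" "p \<ge> 1" "t \<noteq> 0"
  shows "grad (taylor_poly p f x) (x + t *\<^sub>R h) =
    grad f x + (\<Sum>i=2..p. (t ^ (i - 1) / fact (i - 1)) *\<^sub>R dir_deriv_dual i f x h)"
proof -
  let ?G = "\<lambda>i. grad (dir_deriv i f x) (t *\<^sub>R h)"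
  have cd: "cont_diff_at i f x" if "i \<le> p" for i
    using assms(1) that by (rule cont_diff_at_le)
  have "((\<lambda>y. dir_deriv i f x (y - x)) has_derivative blinfun_apply (?G i)) (at (x + t *\<^sub>R h))"
    if "i \<le> p" for i
  proof -
    have "((\<lambda>y. y - x) has_derivative (\<lambda>d. d)) (at (x + t *\<^sub>R h))"
      by (auto intro!: derivative_eq_intros)
    moreover have "(dir_deriv i f x has_derivative blinfun_apply (?G i)) (at (x + t *\<^sub>R h - x))"
      using grad_has_derivative[OF dir_deriv_differentiable[OF cd[OF that]]] by simp
    ultimately show ?thesis
      by (rule has_derivative_compose)
  qed
  \<comment> \<open>The leading \<open>0\<close> is the derivative of the constant term
    \<open>f x\<close>.\<close>
  then have "(taylor_poly p f x has_derivative
      (\<lambda>d. 0 + (\<Sum>i=1..p. 1 / fact i * ?G i d))) (at (x + t *\<^sub>R h))"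
    unfolding taylor_poly_def[abs_def]
    by (intro has_derivative_add has_derivative_const has_derivative_sum has_derivative_mult_right)
       auto
  then have "grad (taylor_poly p f x) (x + t *\<^sub>R h) = (\<Sum>i=1..p. (1 / fact i) *\<^sub>R ?G i)"
    by (intro grad_eqI) (simp add: blinfun.sum_left[abs_def] blinfun.scaleR_left)
  \<comment> \<open>The degree-one term is split off, since the sum in \<open>Gamma_p\<close> begins
    at degree two and has \<open>grad f x\<close> in its place.\<close>
  also have "\<dots> = ?G 1 + (\<Sum>i=2..p. (1 / fact i) *\<^sub>R ?G i)"
    using assms(2) by (simp add: sum.atLeast_Suc_atMost numeral_2_eq_2)
  also have "?G 1 = grad f x"
    using cd[OF assms(2)] by (rule grad_dir_deriv_1)
  also have "(\<Sum>i=2..p. (1 / fact i) *\<^sub>R ?G i) =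
      (\<Sum>i=2..p. (t ^ (i - 1) / fact (i - 1)) *\<^sub>R dir_deriv_dual i f x h)"
  proof (rule sum.cong[OF refl])
    fix i
    assume i: "i \<in> {2..p}"
    have "?G i = t ^ (i - 1) *\<^sub>R grad (dir_deriv i f x) h"
      using i cd assms(3) by (intro grad_dir_deriv_scaleR) auto
    \<comment> \<open>The factor \<open>1 / real i\<close> split off the inverse factorial is the
      one built into \<open>dir_deriv_dual\<close>.\<close>
    moreover have "(fact i :: real) = real i * fact (i - 1)"
      using i by (intro fact_reduce) auto
    ultimately show "(1 / fact i) *\<^sub>R ?G i =
        (t ^ (i - 1) / fact (i - 1)) *\<^sub>R dir_deriv_dual i f x h"
      by (simp add: dir_deriv_dual_def)
  qed
  finally show ?thesis .
qed

section \<open>Comparison of the two gradients\<close>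

text \<open>Once the gradient of the Taylor polynomial is written out, the left side is one of the
  terms over which \<open>Gamma_p\<close> takes the supremum.\<close>

lemma Gamma_p_bound:
  assumes "cont_diff_at p f x" "p \<ge> 1" "x \<in> Q" "y \<in> Q" "v \<in> Q" "0 < t" "t \<le> 1"
  shows "ennreal (1 / t ^ p *
      \<bar>(grad f (x + t *\<^sub>R (v - x)) - grad (taylor_poly p f x) (x + t *\<^sub>R (v - x))) (v - y)\<bar>)
    \<le> Gamma_p p Q f"
proof -
  have grad: "grad (taylor_poly p f x) (x + t *\<^sub>R (v - x)) =
      grad f x + (\<Sum>i=2..p. (t ^ (i - 1) / fact (i - 1)) *\<^sub>R dir_deriv_dual i f x (v - x))"
    using assms by (intro grad_taylor_poly) auto
  have "(x, y, v, t) \<in> Q \<times> Q \<times> Q \<times> {0<..1}"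
    using assms by simp
  then show ?thesis
    unfolding Gamma_p_def by (rule SUP_upper2) (simp only: prod.case grad diff_diff_eq order_refl)
qed

theorem theorem5:
  fixes f :: "'a::euclidean_space \<Rightarrow> real"
    and domf :: "'a set"
    and \<psi> :: "'a \<Rightarrow> ereal"
    and p :: nat
    and x\<^sub>k xbar vbar :: 'a
    and \<gamma> \<xi> c :: real
  assumes "proper_closed_convex \<psi>"
    and "bounded (eff_dom \<psi>)"
    and "convex_on domf f"
    and "eff_dom \<psi> \<subseteq> interior domf"
    and "p \<ge> 1"
    and "\<forall>x\<in>eff_dom \<psi>. cont_diff_at p f x"
    and "x\<^sub>k \<in> eff_dom \<psi>"
    and "0 < \<gamma>" and "\<gamma> \<le> 1"
    and "vbar \<in> eff_dom \<psi>"
    and "xbar = (1 - \<gamma>) *\<^sub>R x\<^sub>k + \<gamma> *\<^sub>R vbar"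
    and "\<xi> \<ge> 0"
    and "\<forall>v\<in>eff_dom \<psi>.
           ereal (blinfun_apply (grad (taylor_poly p f x\<^sub>k) xbar) (v - vbar)) + \<psi> v
             \<ge> \<psi> vbar - ereal (1 / \<gamma> * \<xi>)"
    and "c \<ge> 0"
    and "\<xi> \<le> c * \<gamma> ^ (p + 1)"
  shows "\<forall>v\<in>eff_dom \<psi>.
           ereal (blinfun_apply (grad f xbar) (v - vbar)) + \<psi> v
             \<ge> \<psi> vbar - ereal (1 / \<gamma>) *
                 ((ereal c + enn2ereal (Gamma_p p (eff_dom \<psi>) f)) * ereal (\<gamma> ^ (p + 1)))"
proof
  fix v
  assume v: "v \<in> eff_dom \<psi>"
  let ?\<Gamma> = "Gamma_p p (eff_dom \<psi>) f"
  define A where "A = grad (taylor_poly p f x\<^sub>k) xbar (v - vbar)"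
  define B where "B = grad f xbar (v - vbar)"
  have xbar: "xbar = x\<^sub>k + \<gamma> *\<^sub>R (vbar - x\<^sub>k)"
    using assms(11) by (simp add: algebra_simps)
  \<comment> \<open>Properness excludes the value \<open>-\<infinity>\<close>, so on the domain the
    claim reduces to an inequality between reals.\<close>
  have finite: "\<exists>r. \<psi> w = ereal r" if "w \<in> eff_dom \<psi>" for w
    using assms(1) that by (cases "\<psi> w") (auto simp: proper_closed_convex_def eff_dom_def)
  obtain r where r: "\<psi> v = ereal r"
    using finite[OF v] by blast
  obtain s where s: "\<psi> vbar = ereal s"
    using finite[OF assms(10)] by blast
  show "ereal (grad f xbar (v - vbar)) + \<psi> v \<ge> \<psi> vbar - ereal (1 / \<gamma>) *
      ((ereal c + enn2ereal ?\<Gamma>) * ereal (\<gamma> ^ (p + 1)))"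
  proof (cases ?\<Gamma>)
    case top
    \<comment> \<open>An infinite \<open>?\<Gamma>\<close> stays infinite after multiplication by
      positive reals; as \<open>\<psi> vbar\<close> is finite, the right side is
      \<open>-\<infinity>\<close>.\<close>
    then show ?thesis
      using assms(8) s by simp
  next
    case (real G)
    \<comment> \<open>In \<open>Gamma_p\<close> the endpoint of the segment comes first in the
      pairing, so the direction is \<open>vbar - v\<close> and the sign flips.\<close>
    have "(grad f xbar - grad (taylor_poly p f x\<^sub>k) xbar) (vbar - v) = A - B"
      by (simp add: A_def B_def blinfun.diff_left blinfun.diff_right)
    then have "ennreal (1 / \<gamma> ^ p * \<bar>A - B\<bar>) \<le> ?\<Gamma>"
      using Gamma_p_bound[of p f x\<^sub>k "eff_dom \<psi>" v vbar \<gamma>] assms(5-10) v xbar by simp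
    then have "1 / \<gamma> ^ p * \<bar>A - B\<bar> \<le> G"
      using real by (simp add: ennreal_le_iff)
    then have AB: "\<bar>A - B\<bar> \<le> G * \<gamma> ^ p"
      using assms(8) by (simp add: field_simps)
    \<comment> \<open>Dividing by \<gamma> turns the order \<open>p + 1\<close> of the given error
      into \<open>p\<close>, the order of the bound on \<open>\<bar>A - B\<bar>\<close>.\<close>
    have "1 / \<gamma> * \<xi> \<le> 1 / \<gamma> * (c * \<gamma> ^ (p + 1))"
      using assms(8,15) by (intro mult_left_mono) auto
    then have "1 / \<gamma> * \<xi> \<le> c * \<gamma> ^ p"
      using assms(8) by simp
    moreover have "s - 1 / \<gamma> * \<xi> \<le> A + r"
      using assms(13) v r s by (auto simp: A_def)
    \<comment> \<open>Replacing \<open>A\<close> by \<open>B\<close> costs at most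
      \<open>G * \<gamma> ^ p\<close>, on top of the \<open>c * \<gamma> ^ p\<close> from the
      inexact solution.\<close>
    ultimately have "s - (c + G) * \<gamma> ^ p \<le> B + r"
      using AB by (simp add: algebra_simps)
    moreover have "1 / \<gamma> * ((c + G) * \<gamma> ^ (p + 1)) = (c + G) * \<gamma> ^ p"
      using assms(8) by simp
    ultimately have "s - 1 / \<gamma> * ((c + G) * \<gamma> ^ (p + 1)) \<le> B + r"
      by simp
    then show ?thesis
      using real r s by (simp add: enn2ereal_ennreal B_def del: power_Suc)
  qed
qed

end
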